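(* Let $E$ be a compact metric space, let $\{S(t)\}_{t\ge0}$ be the strongly continuous transition semigroup on $C(E)$ of a time-homogeneous Markov process with càdlàg paths, with generator $(A,\mathcal{D}(A))$, and let $(D,\tau_D)$ satisfy the core conditions (1)–(8) of the context. Then for all $t\ge0$, $f\in C(E)$ and $\mu\in\mathcal{P}(E)$, $$\mathbf{V}(t)[f](\mu)\le\langle V(t)f,\mu\rangle,$$ where $V(t)f=\log S(t)e^f$, $[f](\mu)=\langle f,\mu\rangle$ and $$\mathbf{V}(t)G(\mu)=\sup_{\nu\in\mathcal{AC}_\mu}\Big\{G(\nu(t))-\int_0^t\mathcal{L}(\nu(s),\dot\nu(s))\,ds\Big\}.$$
   Context: $\|\cdot\|$ is the sup norm; $\mathcal{P}(E)$ carries the weak topology; $\langle f,\mu\rangle=\int f\,d\mu$; $\mathbb{R}^+=[0,\infty)$. For $f\in D$, $Hf=e^{-f}Ae^f$. Core conditions for $(D,\tau_D)$, $D\subseteq\mathcal{D}(A)$: (1) $D$ is dense in $C(E)$ and for every $f\in\mathcal{D}(A)$ there are $f_n\in D$ with $f_n\to f$, $Af_n\to Af$ in sup norm; (2) $f,g\in D$ implies $fg\in D$; (3) if $f\in D$ and $\phi:\mathbb{R}\to\mathbb{R}$ is smooth on the range of $f$, then $\phi\circ f\in D$; (4) $(D,\tau_D)$ is a separable barrelled locally convex Hausdorff space; (5) $\tau_D$ is finer than the sup norm topology on $D$; (6) if $\phi:[a,b]\to\mathbb{R}$ is smooth with $\phi(0)=0$, then $f\mapsto\phi\circ f$, from $\{f\in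 D:f(E)\subseteq[a,b]\}$ to $D$, is $\tau_D$-to-$\tau_D$ continuous; (7) $A:(D,\tau_D)\to(C(E),\|\cdot\|)$ is continuous; (8) there is a barrel $\mathcal{N}\subseteq(D,\tau_D)$ (closed, convex, balanced, absorbing set) with $\sup_{f\in c\mathcal{N}}\|Hf\|<\infty$ for every $c>0$. $D'$ is the continuous dual of $(D,\tau_D)$ with the weak* topology, and $\mathcal{L}(\mu,u)=\sup_{f\in D}\{\langle f,u\rangle-\langle Hf,\mu\rangle\}\in[0,\infty]$ for $\mu\in\mathcal{P}(E)$, $u\in D'$. $\mathcal{AC}_\mu$ is the set of continuous paths $\nu:\mathbb{R}^+\to\mathcal{P}(E)$ with $\nu(0)=\mu$ for which there is a weak*-measurable curve $s\mapsto u(s)\in D'$ with $\int_0^t|\langle f,u(s)\rangle|ds<\infty$ and $\langle f,\nu(t)\rangle-\langle f,\nu(0)\rangle=\int_0^t\langle f,u(s)\rangle ds$ for all $f\in D$, $t\ge0$; then $\dot\nu(s):=u(s)$. *)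

theory Defs
  imports "HOL-Probability.Probability"
begin

section \<open>Continuous functions on a compact space\<close>

text \<open>For a compact space \<open>E\<close>, given as a type, \<open>C(E)\<close> with the sup norm is the type of bounded
  continuous functions. All functions passed to \<^const>\<open>Bcontfun\<close> below are continuous,
  hence bounded by compactness.\<close>

definition comp_C :: "(real \<Rightarrow> real) \<Rightarrow> ('a::topological_space \<Rightarrow>\<^sub>C real) \<Rightarrow> ('a \<Rightarrow>\<^sub>C real)" where
  "comp_C \<phi> f = Bcontfun (\<lambda>x. \<phi> (f x))"

definition mult_C :: "('a::topological_space \<Rightarrow>\<^sub>C real) \<Rightarrow> ('a \<Rightarrow>\<^sub>C real) \<Rightarrow> ('a \<Rightarrow>\<^sub>C real)" where
  "mult_C f g = Bcontfun (\<lambda>x. f x * g x)"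

text \<open>Smoothness on an arbitrary set \<open>K\<close>: existence of a smooth extension to an open
  neighbourhood of \<open>K\<close>.\<close>

definition smooth_on :: "real set \<Rightarrow> (real \<Rightarrow> real) \<Rightarrow> bool" where
  "smooth_on K \<phi> \<longleftrightarrow> (\<exists>U \<psi>. open U \<and> K \<subseteq> U \<and> (\<forall>x\<in>K. \<psi> x = \<phi> x) \<and>
     (\<forall>n. ((deriv ^^ n) \<psi>) differentiable_on U))"


section \<open>Semigroups, generators and Markov processes\<close>

definition strongly_continuous_semigroup ::
    "(real \<Rightarrow> 'b::real_normed_vector \<Rightarrow> 'b) \<Rightarrow> bool" where
  "strongly_continuous_semigroup S \<longleftrightarrow>
     (\<forall>t\<ge>0. bounded_linear (S t)) \<and>
     (\<forall>f. S 0 f = f) \<and>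
     (\<forall>s\<ge>0. \<forall>t\<ge>0. \<forall>f. S (s + t) f = S s (S t f)) \<and>
     (\<forall>f. ((\<lambda>t. S t f) \<longlongrightarrow> f) (at_right 0))"

definition gen_dom :: "(real \<Rightarrow> 'b::real_normed_vector \<Rightarrow> 'b) \<Rightarrow> 'b set" where
  "gen_dom S = {f. \<exists>g. ((\<lambda>t. (1 / t) *\<^sub>R (S t f - f)) \<longlongrightarrow> g) (at_right 0)}"

definition gen :: "(real \<Rightarrow> 'b::real_normed_vector \<Rightarrow> 'b) \<Rightarrow> 'b \<Rightarrow> 'b" where
  "gen S f = Lim (at_right 0) (\<lambda>t. (1 / t) *\<^sub>R (S t f - f))"

definition cadlag :: "(real \<Rightarrow> 'a::topological_space) \<Rightarrow> bool" where
  "cadlag \<omega> \<longleftrightarrow> (\<forall>t\<ge>0. (\<omega> \<longlongrightarrow> \<omega> t) (at_right t)) \<and> (\<forall>t>0. \<exists>l. (\<omega> \<longlongrightarrow> l) (at_left t))"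

text \<open>The natural filtration of the process \<open>X\<close> on the measurable space \<open>M\<close>.\<close>

definition past :: "'w measure \<Rightarrow> (real \<Rightarrow> 'w \<Rightarrow> 'a::topological_space) \<Rightarrow> real \<Rightarrow> 'w measure" where
  "past M X s = sigma (space M) {X r -` B \<inter> space M | r B. 0 \<le> r \<and> r \<le> s \<and> B \<in> sets borel}"

text \<open>A time-homogeneous Markov process \<open>X\<close> with cadlag paths, under laws \<open>P x\<close> (started at \<open>x\<close>)
  on a common measurable space \<open>M\<close>, whose transition semigroup on \<open>C(E)\<close> is \<open>S\<close>.\<close>

locale cadlag_markov_process =
  fixes M :: "'w measure"
    and P :: "'a::metric_space \<Rightarrow> 'w measure"
    and X :: "real \<Rightarrow> 'w \<Rightarrow> 'a"
    and S :: "real \<Rightarrow> ('a \<Rightarrow>\<^sub>C real) \<Rightarrow> ('a \<Rightarrow>\<^sub>C real)"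
  assumes sets_P: "sets (P x) = sets M"
    and prob_P: "prob_space (P x)"
    and measurable_X: "t \<ge> 0 \<Longrightarrow> X t \<in> measurable M borel"
    and cadlag_X: "\<omega> \<in> space M \<Longrightarrow> cadlag (\<lambda>t. X t \<omega>)"
    and start: "AE \<omega> in P x. X 0 \<omega> = x"
    and transition: "t \<ge> 0 \<Longrightarrow> S t f x = (\<integral>\<omega>. f (X t \<omega>) \<partial>P x)"
    and markov: "s \<ge> 0 \<Longrightarrow> t \<ge> 0 \<Longrightarrow>
      AE \<omega> in P x. real_cond_exp (P x) (past M X s) (\<lambda>\<omega>. f (X (s + t) \<omega>)) \<omega> = S t f (X s \<omega>)"


section \<open>Barrelled locally convex spaces\<close>

text \<open>The carrier is the topological space's underlying set, a linear subspace of the ambient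
  type.\<close>

definition locally_convex_tvs :: "'v::real_vector topology \<Rightarrow> bool" where
  "locally_convex_tvs T \<longleftrightarrow>
     subspace (topspace T) \<and>
     continuous_map (prod_topology T T) T (\<lambda>(x, y). x + y) \<and>
     continuous_map (prod_topology euclideanreal T) T (\<lambda>(c, x). c *\<^sub>R x) \<and>
     (\<forall>U. openin T U \<and> 0 \<in> U \<longrightarrow> (\<exists>C. openin T C \<and> 0 \<in> C \<and> convex C \<and> C \<subseteq> U))"

definition barrel :: "'v::real_vector topology \<Rightarrow> 'v set \<Rightarrow> bool" where
  "barrel T B \<longleftrightarrow>
     closedin T B \<and> convex B \<and>
     (\<forall>c x. \<bar>c\<bar> \<le> 1 \<and> x \<in> B \<longrightarrow> c *\<^sub>R x \<in> B) \<and>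
     (\<forall>x\<in>topspace T. \<exists>r>0. \<forall>c. \<bar>c\<bar> \<le> r \<longrightarrow> c *\<^sub>R x \<in> B)"

definition barrelled :: "'v::real_vector topology \<Rightarrow> bool" where
  "barrelled T \<longleftrightarrow> (\<forall>B. barrel T B \<longrightarrow> (\<exists>U. openin T U \<and> 0 \<in> U \<and> U \<subseteq> B))"

text \<open>Continuous linear functionals on the carrier; \<^const>\<open>extensional\<close> fixes the irrelevant
  values outside of it.\<close>

definition dual :: "'v::real_vector topology \<Rightarrow> ('v \<Rightarrow> real) set" where
  "dual T = {u \<in> extensional (topspace T).
     (\<forall>x\<in>topspace T. \<forall>y\<in>topspace T. u (x + y) = u x + u y) \<and>
     (\<forall>c. \<forall>x\<in>topspace T. u (c *\<^sub>R x) = c * u x) \<and>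
     continuous_map T euclideanreal u}"


section \<open>The core conditions\<close>

definition Hop :: "(real \<Rightarrow> ('a::topological_space \<Rightarrow>\<^sub>C real) \<Rightarrow> ('a \<Rightarrow>\<^sub>C real)) \<Rightarrow>
    ('a \<Rightarrow>\<^sub>C real) \<Rightarrow> ('a \<Rightarrow>\<^sub>C real)" where
  "Hop S f = mult_C (comp_C (\<lambda>r. exp (- r)) f) (gen S (comp_C exp f))"

locale core_conditions =
  fixes S :: "real \<Rightarrow> ('a::metric_space \<Rightarrow>\<^sub>C real) \<Rightarrow> ('a \<Rightarrow>\<^sub>C real)"
    and D :: "('a \<Rightarrow>\<^sub>C real) set"
    and \<tau> :: "('a \<Rightarrow>\<^sub>C real) topology"
  assumes topspace_D: "topspace \<tau> = D"
    and D_subset: "D \<subseteq> gen_dom S"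
    and dense: "closure D = UNIV"
    and core: "f \<in> gen_dom S \<Longrightarrow>
      \<exists>fn. (\<forall>n::nat. fn n \<in> D) \<and> fn \<longlonglongrightarrow> f \<and> (\<lambda>n. gen S (fn n)) \<longlonglongrightarrow> gen S f"
    and mult_closed: "f \<in> D \<Longrightarrow> g \<in> D \<Longrightarrow> mult_C f g \<in> D"
    and smooth_closed: "f \<in> D \<Longrightarrow> smooth_on (range f) \<phi> \<Longrightarrow> comp_C \<phi> f \<in> D"
    and separable: "separable_space \<tau>"
    and barrelled: "barrelled \<tau>"
    and locally_convex: "locally_convex_tvs \<tau>"
    and Hausdorff: "Hausdorff_space \<tau>"
    and finer: "openin (top_of_set D) U \<Longrightarrow> openin \<tau> U"
    and smooth_continuous: "0 \<in> {a..b} \<Longrightarrow> smooth_on {a..b} \<phi> \<Longrightarrow> \<phi> 0 = 0 \<Longrightarrow>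
      continuous_map (subtopology \<tau> {f \<in> D. range f \<subseteq> {a..b}}) \<tau> (comp_C \<phi>)"
    and gen_continuous: "continuous_map \<tau> euclidean (gen S)"
    and barrel_bound: "\<exists>N. barrel \<tau> N \<and> (\<forall>c>0. bdd_above ((\<lambda>f. norm (Hop S f)) ` (\<lambda>f. c *\<^sub>R f) ` N))"


section \<open>Paths of measures and the two semigroups\<close>

definition Prob :: "'a::topological_space measure set" where
  "Prob = {\<mu>. prob_space \<mu> \<and> sets \<mu> = sets borel}"

definition bracket :: "('a::topological_space \<Rightarrow>\<^sub>C real) \<Rightarrow> 'a measure \<Rightarrow> real" where
  "bracket f \<mu> = (\<integral>x. f x \<partial>\<mu>)"

text \<open>The weak topology: the coarsest one making all maps \<open>\<mu> \<mapsto> \<langle>f, \<mu>\<rangle>\<close>, \<open>f \<in> C(E)\<close>, continuous.\<close>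

definition weak_topology :: "'a::topological_space measure topology" where
  "weak_topology = pullback_topology Prob (\<lambda>\<mu> f. bracket f \<mu>)
     (product_topology (\<lambda>_::'a \<Rightarrow>\<^sub>C real. euclideanreal) UNIV)"

definition Lagrangian :: "(real \<Rightarrow> ('a::topological_space \<Rightarrow>\<^sub>C real) \<Rightarrow> ('a \<Rightarrow>\<^sub>C real)) \<Rightarrow>
    ('a \<Rightarrow>\<^sub>C real) set \<Rightarrow> 'a measure \<Rightarrow> (('a \<Rightarrow>\<^sub>C real) \<Rightarrow> real) \<Rightarrow> ereal" where
  "Lagrangian S D \<mu> u = (SUP f\<in>D. ereal (u f - bracket (Hop S f) \<mu>))"

text \<open>\<open>u\<close> is a velocity of \<open>\<nu>\<close>. Curves are indexed by all reals but only times in \<open>[0, \<infinity>)\<close> matter.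
  Weak*-measurability of \<open>u\<close> means Lebesgue measurability of each \<open>s \<mapsto> \<langle>f, u(s)\<rangle>\<close>.\<close>

definition is_velocity :: "('a::topological_space \<Rightarrow>\<^sub>C real) topology \<Rightarrow> (real \<Rightarrow> 'a measure) \<Rightarrow>
    (real \<Rightarrow> ('a \<Rightarrow>\<^sub>C real) \<Rightarrow> real) \<Rightarrow> bool" where
  "is_velocity \<tau> \<nu> u \<longleftrightarrow>
     (\<forall>s\<ge>0. u s \<in> dual \<tau>) \<and>
     (\<forall>f\<in>topspace \<tau>. (\<lambda>s. u s f) \<in> borel_measurable (lebesgue_on {0..})) \<and>
     (\<forall>f\<in>topspace \<tau>. \<forall>t\<ge>0.
        (\<integral>\<^sup>+s\<in>{0..t}. ennreal \<bar>u s f\<bar> \<partial>lebesgue) < \<infinity> \<and>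
        bracket f (\<nu> t) - bracket f (\<nu> 0) = (LINT s:{0..t}|lebesgue. u s f))"

definition AC :: "('a::topological_space \<Rightarrow>\<^sub>C real) topology \<Rightarrow> 'a measure \<Rightarrow>
    (real \<Rightarrow> 'a measure) set" where
  "AC \<tau> \<mu> = {\<nu>. continuous_map (top_of_set {0..}) weak_topology \<nu> \<and> \<nu> 0 = \<mu> \<and>
     (\<exists>u. is_velocity \<tau> \<nu> u)}"

text \<open>By separability of \<open>D\<close>, two velocities of the same path agree at almost every time, so the
  choice made here does not affect time integrals.\<close>

definition velocity :: "('a::topological_space \<Rightarrow>\<^sub>C real) topology \<Rightarrow> (real \<Rightarrow> 'a measure) \<Rightarrow>
    (real \<Rightarrow> ('a \<Rightarrow>\<^sub>C real) \<Rightarrow> real)" where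
  "velocity \<tau> \<nu> = (SOME u. is_velocity \<tau> \<nu> u)"

text \<open>The variational semigroup \<open>\<^bold>V(t)\<close>. The Lagrangian is nonnegative (take \<open>f = 0\<close>), so passing to
  \<^typ>\<open>ennreal\<close> loses nothing.\<close>

definition Vbold :: "(real \<Rightarrow> ('a::topological_space \<Rightarrow>\<^sub>C real) \<Rightarrow> ('a \<Rightarrow>\<^sub>C real)) \<Rightarrow>
    ('a \<Rightarrow>\<^sub>C real) topology \<Rightarrow> real \<Rightarrow> ('a measure \<Rightarrow> real) \<Rightarrow> 'a measure \<Rightarrow> ereal" where
  "Vbold S \<tau> t G \<mu> = (SUP \<nu>\<in>AC \<tau> \<mu>. ereal (G (\<nu> t)) -
     enn2ereal (\<integral>\<^sup>+s\<in>{0..t}. e2ennreal (Lagrangian S (topspace \<tau>) (\<nu> s) (velocity \<tau> \<nu> s)) \<partial>lebesgue))"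

definition Vlog :: "(real \<Rightarrow> ('a::topological_space \<Rightarrow>\<^sub>C real) \<Rightarrow> ('a \<Rightarrow>\<^sub>C real)) \<Rightarrow>
    real \<Rightarrow> ('a \<Rightarrow>\<^sub>C real) \<Rightarrow> ('a \<Rightarrow>\<^sub>C real)" where
  "Vlog S t f = comp_C ln (S t (comp_C exp f))"

end

theory Submission
  imports Defs
begin

text \<open>If \<open>g(s) = V(t - s) f\<close> were a smooth curve in \<open>D\<close>, then
  \<open>d/ds \<langle>g(s), \<nu>(s)\<rangle> = \<langle>g(s), u(s)\<rangle> - \<langle>H g(s), \<nu>(s)\<rangle> \<le> \<L>(\<nu>(s), u(s))\<close> and integration over
  \<open>[0, t]\<close> would give the claim. For \<open>e\<^sup>f\<close> in the domain of the generator, \<open>g(s)\<close> need not be in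
  \<open>D\<close>, but \<open>[0, t]\<close> can be cut into short steps and \<open>g\<close> replaced on each step by a frozen element
  of \<open>D\<close> that is close to the value at the beginning of the step together with its image under \<open>H\<close>;
  such an element exists because \<open>D\<close> is a core. The accumulated error vanishes with the mesh
  because \<open>(p, s) \<mapsto> \<langle>H log S(p) e\<^sup>f, \<nu>(s)\<rangle>\<close> is uniformly continuous. Arbitrary \<open>f\<close> follow by density.\<close>

section \<open>Continuous functions on a compact space\<close>

lemma bcontfun_compactI:
  fixes f :: "'a::metric_space \<Rightarrow> real"
  assumes "compact (UNIV :: 'a set)" "continuous_on UNIV f"
  shows "f \<in> bcontfun"
  using assms compact_continuous_image[of UNIV f] by (auto simp: bcontfun_def intro: compact_imp_bounded)

lemma comp_C_apply:
  fixes f :: "'a::metric_space \<Rightarrow>\<^sub>C real"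
  assumes "compact (UNIV :: 'a set)" "continuous_on (range f) \<phi>"
  shows "comp_C \<phi> f x = \<phi> (f x)"
proof -
  have "continuous_on UNIV (\<lambda>x. \<phi> (f x))"
    by (rule continuous_on_compose2[OF assms(2)]) auto
  then show ?thesis
    unfolding comp_C_def by (simp add: Bcontfun_inverse bcontfun_compactI[OF assms(1)])
qed

lemma mult_C_apply:
  fixes f g :: "'a::metric_space \<Rightarrow>\<^sub>C real"
  assumes "compact (UNIV :: 'a set)"
  shows "mult_C f g x = f x * g x"
  unfolding mult_C_def
  by (subst Bcontfun_inverse) (auto intro!: bcontfun_compactI[OF assms] continuous_intros)

lemma comp_exp_apply:
  fixes f :: "'a::metric_space \<Rightarrow>\<^sub>C real"
  assumes "compact (UNIV :: 'a set)"
  shows "comp_C exp f x = exp (f x)"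
  by (rule comp_C_apply[OF assms]) (auto intro!: continuous_intros)

lemma comp_ln_apply:
  fixes f :: "'a::metric_space \<Rightarrow>\<^sub>C real"
  assumes "compact (UNIV :: 'a set)" "\<And>x. 0 < f x"
  shows "comp_C ln f x = ln (f x)"
proof (rule comp_C_apply[OF assms(1)])
  have "f x \<noteq> 0" for x using assms(2)[of x] by simp
  then show "continuous_on (range f) ln" by (auto intro!: continuous_on_ln continuous_on_id)
qed

lemma comp_inverse_apply:
  fixes f :: "'a::metric_space \<Rightarrow>\<^sub>C real"
  assumes "compact (UNIV :: 'a set)" "\<And>x. 0 < f x"
  shows "comp_C inverse f x = inverse (f x)"
proof (rule comp_C_apply[OF assms(1)])
  have "f x \<noteq> 0" for x using assms(2)[of x] by simp
  then show "continuous_on (range f) inverse" by (auto intro!: continuous_on_inverse continuous_on_id)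
qed

lemma comp_exp_ln:
  fixes f :: "'a::metric_space \<Rightarrow>\<^sub>C real"
  assumes "compact (UNIV :: 'a set)" "\<And>x. 0 < f x"
  shows "comp_C exp (comp_C ln f) = f"
  by (rule bcontfun_eqI) (simp add: comp_exp_apply comp_ln_apply assms)

lemma comp_ln_exp:
  fixes f :: "'a::metric_space \<Rightarrow>\<^sub>C real"
  assumes "compact (UNIV :: 'a set)"
  shows "comp_C ln (comp_C exp f) = f"
  by (rule bcontfun_eqI) (simp add: comp_exp_apply comp_ln_apply assms)

lemma positive_lower_bound:
  fixes f :: "'a::metric_space \<Rightarrow>\<^sub>C real"
  assumes "compact (UNIV :: 'a set)" "\<And>x. 0 < f x"
  obtains m where "m > 0" "\<And>x. m \<le> f x"
proof -
  obtain x where "\<And>y. f x \<le> f y"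
    using continuous_attains_inf[of UNIV f] assms(1) by auto
  with assms(2) that show thesis by blast
qed

section \<open>Sup norm convergence under products and compositions\<close>

text \<open>The gap between \<open>m\<close> and \<open>m'\<close> absorbs the sup norm distance.
  This keeps approximants of a strictly positive limit in a half-line where logarithm and inverse
  are Lipschitz.\<close>

lemma eventually_bounded_below_bcontfun:
  fixes F :: "'i \<Rightarrow> 'a::metric_space \<Rightarrow>\<^sub>C real"
  assumes "(F \<longlongrightarrow> G) net" "m < m'" "\<And>x. m' \<le> G x"
  shows "eventually (\<lambda>i. \<forall>x. m \<le> F i x) net"
proof -
  have "eventually (\<lambda>i. dist (F i) G < m' - m) net"
    using assms by (auto intro: tendstoD)
  then show ?thesis
  proof eventually_elim
    case (elim i)
    show ?case
    proof
      fix x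
      have "dist (F i x) (G x) < m' - m"
        using dist_bounded[of "F i" x G] elim by simp
      then show "m \<le> F i x" using assms(3)[of x] by (auto simp: dist_real_def)
    qed
  qed
qed

lemma tendsto_mult_C:
  fixes F G :: "'i \<Rightarrow> 'a::metric_space \<Rightarrow>\<^sub>C real"
  assumes "compact (UNIV :: 'a set)" "(F \<longlongrightarrow> F') net" "(G \<longlongrightarrow> G') net"
  shows "((\<lambda>i. mult_C (F i) (G i)) \<longlongrightarrow> mult_C F' G') net"
proof -
  have "norm (mult_C (F i) (G i) - mult_C F' G') \<le> norm (F i) * norm (G i - G') + norm (F i - F') * norm G'" for i
  proof (rule norm_bound)
    fix x
    have "\<bar>F i x\<bar> * \<bar>G i x - G' x\<bar> \<le> norm (F i) * norm (G i - G')"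
      using norm_bounded[of "F i" x] norm_bounded[of "G i - G'" x] by (intro mult_mono) auto
    moreover have "\<bar>F i x - F' x\<bar> * \<bar>G' x\<bar> \<le> norm (F i - F') * norm G'"
      using norm_bounded[of "F i - F'" x] norm_bounded[of G' x] by (intro mult_mono) auto
    moreover have "F i x * G i x - F' x * G' x = F i x * (G i x - G' x) + (F i x - F' x) * G' x"
      by (simp add: algebra_simps)
    ultimately show "norm ((mult_C (F i) (G i) - mult_C F' G') x) \<le> norm (F i) * norm (G i - G') + norm (F i - F') * norm G'"
      using abs_triangle_ineq[of "F i x * (G i x - G' x)" "(F i x - F' x) * G' x"]
      by (simp add: mult_C_apply[OF assms(1)] abs_mult)
  qed
  moreover have "((\<lambda>i. norm (F i) * norm (G i - G') + norm (F i - F') * norm G') \<longlongrightarrow> norm F' * norm (G' - G') + norm (F' - F') * norm G') net"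
    by (intro tendsto_add tendsto_mult tendsto_norm tendsto_diff tendsto_const assms)
  then have "((\<lambda>i. norm (F i) * norm (G i - G') + norm (F i - F') * norm G') \<longlongrightarrow> 0) net" by simp
  ultimately show ?thesis
    by (rule LIM_zero_cancel[OF Lim_null_comparison[OF always_eventually[OF allI]]])
qed

text \<open>A Lipschitz bound is asked only on a half-line, because \<open>ln\<close> and
  \<open>inverse\<close> have none near 0; eventually both \<open>F i\<close> and \<open>G\<close>
  take their values in that half-line.\<close>

lemma tendsto_comp_C:
  fixes F :: "'i \<Rightarrow> 'a::metric_space \<Rightarrow>\<^sub>C real"
  assumes E: "compact (UNIV :: 'a set)" and lim: "(F \<longlongrightarrow> G) net"
    and m: "m < m'" "\<And>x. m' \<le> G x"
    and lip: "L-lipschitz_on {m..} \<phi>"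
  shows "((\<lambda>i. comp_C \<phi> (F i)) \<longlongrightarrow> comp_C \<phi> G) net"
proof -
  have L: "0 \<le> L" using lip by (rule lipschitz_on_nonneg)
  have cont: "continuous_on {m..} \<phi>" using lip by (rule lipschitz_on_continuous_on)
  have mG: "m \<le> G x" for x using m(1) m(2)[of x] by simp
  then have "comp_C \<phi> G x = \<phi> (G x)" for x
    by (auto intro!: comp_C_apply[OF E] continuous_on_subset[OF cont])
  note G = this mG
  have "eventually (\<lambda>i. norm (comp_C \<phi> (F i) - comp_C \<phi> G) \<le> L * norm (F i - G)) net"
    using eventually_bounded_below_bcontfun[OF lim m]
  proof eventually_elim
    case (elim i)
    show ?case
    proof (rule norm_bound)
      fix x
      have "comp_C \<phi> (F i) x = \<phi> (F i x)"
        using elim by (auto intro!: comp_C_apply[OF E] continuous_on_subset[OF cont])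
      moreover have "dist (\<phi> (F i x)) (\<phi> (G x)) \<le> L * dist (F i x) (G x)"
        using elim G by (auto intro: lipschitz_onD[OF lip])
      moreover have "dist (F i x) (G x) \<le> norm (F i - G)"
        using dist_bounded[of "F i" x G] by (simp add: dist_norm)
      ultimately show "norm ((comp_C \<phi> (F i) - comp_C \<phi> G) x) \<le> L * norm (F i - G)"
        using L mult_left_mono[of "dist (F i x) (G x)" "norm (F i - G)" L] by (simp add: G dist_norm)
    qed
  qed
  moreover have "((\<lambda>i. L * norm (F i - G)) \<longlongrightarrow> L * norm (G - G)) net"
    by (intro tendsto_mult tendsto_norm tendsto_diff tendsto_const lim)
  then have "((\<lambda>i. L * norm (F i - G)) \<longlongrightarrow> 0) net" by simp
  ultimately show ?thesis by (rule LIM_zero_cancel[OF Lim_null_comparison])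
qed

lemma lipschitz_on_ln_atLeast:
  assumes "0 < m" shows "(1 / m)-lipschitz_on {m..} (ln :: real \<Rightarrow> real)"
proof (rule bounded_derivative_imp_lipschitz[where f'="\<lambda>x y. y / x"])
  fix x assume "x \<in> {m..}"
  then show "(ln has_derivative (\<lambda>y. y / x)) (at x within {m..})"
    using assms by (auto intro!: derivative_eq_intros simp: field_simps)
  show "onorm (\<lambda>y. y / x) \<le> 1 / m"
    using \<open>x \<in> {m..}\<close> assms
    by (intro onorm_bound) (auto simp: abs_mult divide_simps intro!: mult_left_mono)
qed (use assms in auto)

lemma lipschitz_on_inverse_atLeast:
  assumes "0 < m" shows "(1 / m\<^sup>2)-lipschitz_on {m..} (inverse :: real \<Rightarrow> real)"
proof (rule lipschitz_onI)
  fix x y assume *: "x \<in> {m..}" "y \<in> {m..}"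
  have "m\<^sup>2 \<le> x * y" using * assms by (auto simp: power2_eq_square intro: mult_mono)
  then have "\<bar>x - y\<bar> / (x * y) \<le> \<bar>x - y\<bar> / m\<^sup>2"
    using assms * by (intro divide_left_mono mult_pos_pos) auto
  moreover have "dist (inverse x) (inverse y) = \<bar>x - y\<bar> / (x * y)"
    using * assms by (auto simp: dist_real_def field_simps abs_divide abs_mult abs_minus_commute)
  ultimately show "dist (inverse x) (inverse y) \<le> 1 / m\<^sup>2 * dist x y"
    by (simp add: dist_real_def)
qed (use assms in auto)

lemma tendsto_comp_ln:
  fixes F :: "'i \<Rightarrow> 'a::metric_space \<Rightarrow>\<^sub>C real"
  assumes E: "compact (UNIV :: 'a set)" and lim: "(F \<longlongrightarrow> G) net" and G: "\<And>x. 0 < G x"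
  shows "((\<lambda>i. comp_C ln (F i)) \<longlongrightarrow> comp_C ln G) net"
proof -
  obtain m where m: "m > 0" "\<And>x. m \<le> G x" using positive_lower_bound[OF E G] by blast
  then show ?thesis
    by (intro tendsto_comp_C[OF E lim _ m(2) lipschitz_on_ln_atLeast[of "m/2"]]) auto
qed

lemma tendsto_comp_inverse:
  fixes F :: "'i \<Rightarrow> 'a::metric_space \<Rightarrow>\<^sub>C real"
  assumes E: "compact (UNIV :: 'a set)" and lim: "(F \<longlongrightarrow> G) net" and G: "\<And>x. 0 < G x"
  shows "((\<lambda>i. comp_C inverse (F i)) \<longlongrightarrow> comp_C inverse G) net"
proof -
  obtain m where m: "m > 0" "\<And>x. m \<le> G x" using positive_lower_bound[OF E G] by blast
  then show ?thesis
    by (intro tendsto_comp_C[OF E lim _ m(2) lipschitz_on_inverse_atLeast[of "m/2"]]) auto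
qed

section \<open>The operator H in the variable h = e^f\<close>

text \<open>Writing f = ln h replaces the nonlinear H by the linear generator followed by division
  by h, so that the core property, which concerns graph convergence of the generator, can be
  applied.\<close>

lemma Hop_ln:
  fixes h :: "'a::metric_space \<Rightarrow>\<^sub>C real"
  assumes E: "compact (UNIV :: 'a set)" and h: "\<And>x. 0 < h x"
  shows "Hop S (comp_C ln h) = mult_C (comp_C inverse h) (gen S h)"
proof -
  have "comp_C (\<lambda>r. exp (- r)) (comp_C ln h) = comp_C inverse h"
  proof (rule bcontfun_eqI)
    fix x
    have "comp_C (\<lambda>r. exp (- r)) (comp_C ln h) x = exp (- (comp_C ln h x))"
      by (rule comp_C_apply[OF E]) (auto intro!: continuous_intros)
    moreover have "comp_C inverse h x = inverse (h x)"
      by (rule comp_inverse_apply[OF E h])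
    ultimately show "comp_C (\<lambda>r. exp (- r)) (comp_C ln h) x = comp_C inverse h x"
      using h[of x] by (simp add: comp_ln_apply[OF E h] exp_minus)
  qed
  then show ?thesis by (simp add: Hop_def comp_exp_ln[OF E h])
qed

lemma Hop_ln_apply:
  fixes h :: "'a::metric_space \<Rightarrow>\<^sub>C real"
  assumes E: "compact (UNIV :: 'a set)" and h: "\<And>x. 0 < h x"
  shows "Hop S (comp_C ln h) x = gen S h x / h x"
proof -
  show ?thesis by (simp add: comp_inverse_apply[OF E h] Hop_ln[OF E h] mult_C_apply[OF E] divide_inverse mult.commute)
qed

lemma tendsto_Hop_ln:
  fixes F :: "'i \<Rightarrow> 'a::metric_space \<Rightarrow>\<^sub>C real"
  assumes E: "compact (UNIV :: 'a set)"
    and lim: "(F \<longlongrightarrow> G) net" "((\<lambda>i. gen S (F i)) \<longlongrightarrow> gen S G) net" and G: "\<And>x. 0 < G x"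
  shows "((\<lambda>i. Hop S (comp_C ln (F i))) \<longlongrightarrow> Hop S (comp_C ln G)) net"
proof -
  obtain m where m: "m > 0" "\<And>x. m \<le> G x" using positive_lower_bound[OF E G] by blast
  have "((\<lambda>i. mult_C (comp_C inverse (F i)) (gen S (F i))) \<longlongrightarrow> Hop S (comp_C ln G)) net"
    unfolding Hop_ln[OF E G] by (intro tendsto_mult_C tendsto_comp_inverse E lim G)
  \<comment> \<open>The quotient formula for H requires \<open>F i\<close> to be positive
    everywhere, which the limit being positive guarantees only eventually.\<close>
  moreover have "eventually (\<lambda>i. \<forall>x. m/2 \<le> F i x) net"
    using m by (intro eventually_bounded_below_bcontfun[OF lim(1) _ m(2)]) auto
  then have "eventually (\<lambda>i. mult_C (comp_C inverse (F i)) (gen S (F i)) = Hop S (comp_C ln (F i))) net"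
  proof eventually_elim
    case (elim i)
    have "0 < F i x" for x using elim m(1) less_le_trans[of 0 "m/2" "F i x"] by simp
    from Hop_ln[OF E this] show ?case by simp
  qed
  ultimately show ?thesis by (rule Lim_transform_eventually)
qed

section \<open>Smoothness of the logarithm\<close>

lemma smooth_on_ln:
  assumes "K \<subseteq> {0<..}" shows "smooth_on K ln"
proof -
  \<comment> \<open>From order one on, each derivative is a multiple of a power of 1/x; the value of
    the factor does not matter for differentiability. Order zero is the logarithm itself and is
    treated separately.\<close>
  have deriv_ln: "\<exists>c. \<forall>x>(0::real). (deriv ^^ Suc n) ln x = c * inverse x ^ Suc n" for n
  proof (induction n)
    case 0
    have "deriv ln x = inverse x" if "x > 0" for x :: real
      using that DERIV_ln by (intro DERIV_imp_deriv)
    then show ?case by (auto intro!: exI[of _ 1])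
  next
    case (Suc n)
    then obtain c where c: "\<And>x::real. x > 0 \<Longrightarrow> (deriv ^^ Suc n) ln x = c * inverse x ^ Suc n" by blast
    have "(deriv ^^ Suc (Suc n)) ln x = - c * real (Suc n) * inverse x ^ Suc (Suc n)" if "x > 0" for x :: real
    proof -
      have "((\<lambda>x. c * inverse x ^ Suc n) has_field_derivative
          c * ((1 + of_nat n) * (- (inverse x ^ Suc (Suc 0)) * inverse x ^ n))) (at x)"
        using that by (intro DERIV_cmult DERIV_power_Suc DERIV_inverse) simp
      also have "c * ((1 + of_nat n) * (- (inverse x ^ Suc (Suc 0)) * inverse x ^ n))
          = - c * real (Suc n) * inverse x ^ Suc (Suc n)"
        by (simp add: algebra_simps)
      finally have "((\<lambda>x. c * inverse x ^ Suc n) has_field_derivative - c * real (Suc n) * inverse x ^ Suc (Suc n)) (at x)" .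
      then have "((deriv ^^ Suc n) ln has_field_derivative - c * real (Suc n) * inverse x ^ Suc (Suc n)) (at x)"
        by (rule has_field_derivative_transform_within_open[of _ _ _ "{0<..}"]) (use that c in auto)
      then show ?thesis by (simp add: DERIV_imp_deriv)
    qed
    then show ?case by blast
  qed
  have "((deriv ^^ n) ln) differentiable_on {0::real<..}" for n
  proof (cases n)
    case 0
    have "(ln :: real \<Rightarrow> real) differentiable (at x within {0<..})" if "x > 0" for x
      using that by (auto simp: differentiable_def intro!: exI derivative_intros)
    with 0 show ?thesis by (simp add: differentiable_on_def)
  next
    case (Suc k)
    obtain c where c: "\<And>x::real. x > 0 \<Longrightarrow> (deriv ^^ n) ln x = c * inverse x ^ n"
      using deriv_ln[of k] Suc by blast
    show ?thesis
      unfolding differentiable_on_def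
    proof
      fix x :: real assume x: "x \<in> {0<..}"
      then have "(\<lambda>x. c * inverse x ^ n) differentiable (at x within {0<..})"
        by (auto intro!: derivative_intros)
      then show "(deriv ^^ n) ln differentiable (at x within {0<..})"
        by (rule differentiable_transform_within[OF _ zero_less_one x]) (simp add: c)
    qed
  qed
  then show ?thesis
    unfolding smooth_on_def using assms by (intro exI[of _ "{0<..}"] exI[of _ ln]) auto
qed

section \<open>Brackets\<close>

lemma integrable_bcontfun:
  assumes "\<nu> \<in> Prob"
  shows "integrable \<nu> (apply_bcontfun (f :: 'a::metric_space \<Rightarrow>\<^sub>C real))"
proof -
  interpret prob_space \<nu> using assms by (simp add: Prob_def)
  have "apply_bcontfun f \<in> borel_measurable \<nu>"
    using assms borel_measurable_continuous_onI[of f] by (simp add: Prob_def cong: measurable_cong_sets)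
  then show ?thesis
    using norm_bounded[of f] by (intro integrable_const_bound[of _ "norm f"]) auto
qed

lemma bracket_diff:
  assumes "\<nu> \<in> Prob" shows "bracket (f - g) \<nu> = bracket f \<nu> - bracket (g :: 'a::metric_space \<Rightarrow>\<^sub>C real) \<nu>"
  unfolding bracket_def by (simp add: integrable_bcontfun[OF assms])

lemma bracket_scaleR: "bracket (c *\<^sub>R f) \<nu> = c * bracket f \<nu>"
  unfolding bracket_def by (simp add: scaleR_bcontfun.rep_eq)

lemma bracket_le:
  assumes "\<nu> \<in> Prob" "\<And>x. apply_bcontfun f x \<le> (g :: 'a::metric_space \<Rightarrow>\<^sub>C real) x + c"
  shows "bracket f \<nu> \<le> bracket g \<nu> + c"
proof -
  interpret prob_space \<nu> using assms by (simp add: Prob_def)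
  have "bracket f \<nu> \<le> (\<integral>x. g x + c \<partial>\<nu>)"
    unfolding bracket_def using assms(2) by (intro integral_mono) (auto intro: integrable_bcontfun[OF assms(1)])
  also have "\<dots> = bracket g \<nu> + c"
    unfolding bracket_def by (simp add: integrable_bcontfun[OF assms(1)] prob_space)
  finally show ?thesis .
qed

lemma abs_bracket_diff_le:
  assumes "\<nu> \<in> Prob"
  shows "\<bar>bracket f \<nu> - bracket (g :: 'a::metric_space \<Rightarrow>\<^sub>C real) \<nu>\<bar> \<le> norm (f - g)"
proof -
  have "\<bar>f x - g x\<bar> \<le> norm (f - g)" for x using norm_bounded[of "f - g" x] by simp
  then have "f x \<le> g x + norm (f - g)" "g x \<le> f x + norm (f - g)" for x
    by (smt (verit))+
  from bracket_le[OF assms this(1)] bracket_le[OF assms this(2)] show ?thesis by linarith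
qed

lemma tendsto_bracket:
  fixes F :: "'i \<Rightarrow> 'a::metric_space \<Rightarrow>\<^sub>C real"
  assumes "\<nu> \<in> Prob" "(F \<longlongrightarrow> G) net"
  shows "((\<lambda>i. bracket (F i) \<nu>) \<longlongrightarrow> bracket G \<nu>) net"
proof -
  have "((\<lambda>i. norm (F i - G)) \<longlongrightarrow> norm (G - G)) net"
    by (intro tendsto_norm tendsto_diff tendsto_const assms)
  then have lim: "((\<lambda>i. norm (F i - G)) \<longlongrightarrow> 0) net" by simp
  have "norm (bracket (F i) \<nu> - bracket G \<nu>) \<le> norm (F i - G)" for i
    using abs_bracket_diff_le[OF assms(1)] by simp
  from this lim show ?thesis
    by (rule LIM_zero_cancel[OF Lim_null_comparison[OF always_eventually[OF allI]]])
qed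

lemma AC_Prob:
  assumes "\<nu> \<in> AC \<tau> \<mu>" "s \<ge> 0" shows "\<nu> s \<in> Prob"
  using assms continuous_map_funspace[of "top_of_set {0..}" weak_topology \<nu>]
  by (auto simp: AC_def weak_topology_def topspace_pullback_topology)

text \<open>Continuity into the pullback of a product topology passes to each coordinate, and the
  coordinates are the brackets.\<close>

lemma AC_continuous_bracket:
  assumes "\<nu> \<in> AC \<tau> \<mu>" shows "continuous_on {0..} (\<lambda>s. bracket f (\<nu> s))"
proof -
  have "continuous_map (top_of_set {0..}) (product_topology (\<lambda>_. euclideanreal) UNIV) ((\<lambda>\<mu> f. bracket f \<mu>) \<circ> \<nu>)"
    using assms continuous_map_pullback[OF continuous_map_id]
    by (intro continuous_map_compose[of _ weak_topology]) (auto simp: AC_def weak_topology_def o_def)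
  then show ?thesis
    by (auto simp: continuous_map_componentwise_UNIV o_def)
qed

section \<open>The semigroup\<close>

lemma gen_domD:
  assumes "h \<in> gen_dom S"
  shows "((\<lambda>t. (1 / t) *\<^sub>R (S t h - h)) \<longlongrightarrow> gen S h) (at_right 0)"
proof -
  obtain g where "((\<lambda>t. (1 / t) *\<^sub>R (S t h - h)) \<longlongrightarrow> g) (at_right 0)"
    using assms by (auto simp: gen_dom_def)
  then show ?thesis unfolding gen_def by (simp add: tendsto_Lim)
qed

lemma gen_eqI:
  assumes "((\<lambda>t. (1 / t) *\<^sub>R (S t h - h)) \<longlongrightarrow> g) (at_right 0)"
  shows "h \<in> gen_dom S" "gen S h = g"
  using assms by (auto simp: gen_dom_def gen_def intro: tendsto_Lim)

locale feller_core = cadlag_markov_process M P X S + core_conditions S D \<tau>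
  for M :: "'w measure" and P :: "'a::metric_space \<Rightarrow> 'w measure" and X S D \<tau> +
  assumes compact_E: "compact (UNIV :: 'a set)"
    and semigroup: "strongly_continuous_semigroup S"
begin

lemma
  shows S_linear: "t \<ge> 0 \<Longrightarrow> bounded_linear (S t)"
    and S_0: "S 0 h = h"
    and S_add: "s \<ge> 0 \<Longrightarrow> t \<ge> 0 \<Longrightarrow> S (s + t) h = S s (S t h)"
    and S_right_0: "((\<lambda>t. S t h) \<longlongrightarrow> h) (at_right 0)"
  using semigroup by (auto simp: strongly_continuous_semigroup_def)

text \<open>The representation of \<open>S t\<close> as an expectation preserves lower bounds.
  Strict positivity, through compactness, and contractivity are derived from this.\<close>

lemma S_ge:
  assumes "t \<ge> 0" "\<And>x. m \<le> apply_bcontfun h x"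
  shows "m \<le> S t h x"
proof -
  interpret prob_space "P x" by (rule prob_P)
  have "(\<lambda>\<omega>. h (X t \<omega>)) \<in> borel_measurable (P x)"
    using measurable_X[OF assms(1)] borel_measurable_continuous_onI[of h]
    by (auto simp: measurable_cong_sets[OF sets_P refl])
  then have "integrable (P x) (\<lambda>\<omega>. h (X t \<omega>))"
    using norm_bounded[of h] by (intro integrable_const_bound[of _ "norm h"]) auto
  then have "(\<integral>\<omega>. m \<partial>P x) \<le> (\<integral>\<omega>. h (X t \<omega>) \<partial>P x)"
    using assms(2) by (intro integral_mono) auto
  then show ?thesis by (simp add: transition assms prob_space)
qed

lemma S_pos:
  assumes "t \<ge> 0" "\<And>x. 0 < apply_bcontfun h x"
  shows "0 < S t h x"
proof -
  obtain m where "m > 0" "\<And>x. m \<le> h x" using positive_lower_bound[OF compact_E assms(2)] by blast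
  with S_ge[OF assms(1), of m h x] show ?thesis by simp
qed

lemma norm_S_le:
  assumes "t \<ge> 0" shows "norm (S t h) \<le> norm h"
proof (rule norm_bound)
  fix x
  interpret bounded_linear "S t" using S_linear[OF assms] .
  have "- norm h \<le> h x" "- norm h \<le> (- h) x" for x
    using norm_bounded[of h x] by auto
  from S_ge[OF assms this(1)] S_ge[OF assms this(2)] have "- norm h \<le> S t h x" "- norm h \<le> - S t h x"
    by (simp_all add: neg)
  then show "norm (S t h x) \<le> norm h" by (simp add: abs_le_iff)
qed

lemma S_diff:
  assumes "t \<ge> 0" shows "S t (g - h) = S t g - S t h"
  using S_linear[OF assms] by (rule linear_diff[OF bounded_linear.linear])

lemma S_scaleR:
  assumes "t \<ge> 0" shows "S t (c *\<^sub>R h) = c *\<^sub>R S t h"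
  using S_linear[OF assms] by (rule linear_scale[OF bounded_linear.linear])

lemma norm_S_diff_le:
  assumes "0 \<le> s" "s \<le> t"
  shows "norm (S t h - S s h) \<le> norm (S (t - s) h - h)"
  using norm_S_le[of s "S (t - s) h - h"] S_add[of s "t - s" h] assms by (simp add: S_diff)

text \<open>Since \<open>S s\<close> is a contraction, the modulus of right continuity at time 0
  serves at every time, and on the left as well as on the right.\<close>

lemma continuous_on_S: "continuous_on {0..} (\<lambda>t. S t h)"
proof (unfold continuous_on_iff, intro ballI allI impI)
  fix s e :: real assume "s \<in> {0..}" "e > 0"
  have "eventually (\<lambda>r. dist (S r h) h < e) (at_right 0)"
    using S_right_0 \<open>e > 0\<close> by (rule tendstoD)
  then obtain d where d: "d > 0" "\<And>r. 0 < r \<Longrightarrow> r < d \<Longrightarrow> norm (S r h - h) < e"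
    by (auto simp: eventually_at_right_field dist_norm)
  show "\<exists>d>0. \<forall>t\<in>{0..}. dist t s < d \<longrightarrow> dist (S t h) (S s h) < e"
  proof (intro exI[of _ d] conjI ballI impI d)
    fix t assume "t \<in> {0..}" "dist t s < d"
    consider "t = s" | "s < t" | "t < s" by linarith
    then show "dist (S t h) (S s h) < e"
    proof cases
      case 1 then show ?thesis using \<open>e > 0\<close> by simp
    next
      case 2
      then show ?thesis using norm_S_diff_le[of s t h] d(2)[of "t - s"] \<open>s \<in> {0..}\<close> \<open>dist t s < d\<close>
        by (simp add: dist_norm)
    next
      case 3
      then show ?thesis using norm_S_diff_le[of t s h] d(2)[of "s - t"] \<open>t \<in> {0..}\<close> \<open>dist t s < d\<close>
        by (simp add: dist_norm norm_minus_commute)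
    qed
  qed
qed

text \<open>\<open>S t\<close> is bounded and commutes with \<open>S r\<close>, hence carries the
  difference quotients of \<open>h\<close> to those of \<open>S t h\<close>.\<close>

lemma
  assumes "h \<in> gen_dom S" "t \<ge> 0"
  shows S_gen_dom: "S t h \<in> gen_dom S"
    and gen_S: "gen S (S t h) = S t (gen S h)"
proof -
  have "((\<lambda>r. S t ((1 / r) *\<^sub>R (S r h - h))) \<longlongrightarrow> S t (gen S h)) (at_right 0)"
    by (rule bounded_linear.tendsto[OF S_linear[OF assms(2)] gen_domD[OF assms(1)]])
  moreover have "eventually (\<lambda>r. S t ((1 / r) *\<^sub>R (S r h - h)) = (1 / r) *\<^sub>R (S r (S t h) - S t h)) (at_right 0)"
    using eventually_at_right_less[of 0]
  proof eventually_elim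
    case (elim r)
    then have "S t (S r h) = S r (S t h)"
      using S_add[of t r h] S_add[of r t h] assms(2) by (simp add: add.commute)
    then show ?case using assms(2) by (simp add: S_scaleR S_diff)
  qed
  ultimately have "((\<lambda>r. (1 / r) *\<^sub>R (S r (S t h) - S t h)) \<longlongrightarrow> S t (gen S h)) (at_right 0)"
    by (rule Lim_transform_eventually)
  from gen_eqI[where S=S and h="S t h", OF this] show "S t h \<in> gen_dom S" "gen S (S t h) = S t (gen S h)" by auto
qed

text \<open>The generator is taken at the end of the step, since the velocity will be tested against a
  function frozen at its beginning.\<close>

lemma eventually_backward_error_le:
  assumes h: "h \<in> gen_dom S" and "e > 0"
  shows "eventually (\<lambda>r. norm (S r h - h - r *\<^sub>R S r (gen S h)) \<le> r * e) (at_right 0)"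
proof -
  have "((\<lambda>r. norm ((1 / r) *\<^sub>R (S r h - h) - S r (gen S h))) \<longlongrightarrow> norm (gen S h - gen S h)) (at_right 0)"
    by (intro tendsto_norm tendsto_diff gen_domD S_right_0 h)
  then have "((\<lambda>r. norm ((1 / r) *\<^sub>R (S r h - h) - S r (gen S h))) \<longlongrightarrow> 0) (at_right 0)" by simp
  then have "eventually (\<lambda>r. norm ((1 / r) *\<^sub>R (S r h - h) - S r (gen S h)) < e) (at_right 0)"
    using \<open>e > 0\<close> by (rule order_tendstoD(2))
  then show ?thesis
    using eventually_at_right_less[of 0]
  proof eventually_elim
    case (elim r)
    have "S r h - h - r *\<^sub>R S r (gen S h) = r *\<^sub>R ((1 / r) *\<^sub>R (S r h - h) - S r (gen S h))"
      using elim by (simp add: scaleR_diff_right)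
    then have "norm (S r h - h - r *\<^sub>R S r (gen S h)) = r * norm ((1 / r) *\<^sub>R (S r h - h) - S r (gen S h))"
      using elim by simp
    then show ?case using elim by simp
  qed
qed

section \<open>Approximation from the core and the logarithmic step\<close>

text \<open>Graph convergence of core elements to \<open>h\<close> gives convergence of their
  logarithms and of H of these. Once positive, a core element has its logarithm in \<open>D\<close>
  by closure under smooth maps.\<close>

lemma core_approximation:
  assumes h: "h \<in> gen_dom S" and pos: "\<And>x. 0 < h x" and e: "e > 0"
  obtains g where "g \<in> D" "norm (g - comp_C ln h) \<le> e" "norm (Hop S g - Hop S (comp_C ln h)) \<le> e"
proof -
  obtain k where k: "\<And>n::nat. k n \<in> D" "k \<longlonglongrightarrow> h" "(\<lambda>n. gen S (k n)) \<longlonglongrightarrow> gen S h"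
    using core[OF h] by blast
  obtain m where m: "m > 0" "\<And>x. m \<le> h x" using positive_lower_bound[OF compact_E pos] by blast
  have "eventually (\<lambda>n. \<forall>x. m / 2 \<le> k n x) sequentially"
    using m by (intro eventually_bounded_below_bcontfun[OF k(2) _ m(2)]) auto
  moreover have "eventually (\<lambda>n. dist (comp_C ln (k n)) (comp_C ln h) < e) sequentially"
    using tendsto_comp_ln[OF compact_E k(2) pos] e by (rule tendstoD)
  moreover have "eventually (\<lambda>n. dist (Hop S (comp_C ln (k n))) (Hop S (comp_C ln h)) < e) sequentially"
    using tendsto_Hop_ln[OF compact_E k(2,3) pos] e by (rule tendstoD)
  ultimately have "eventually (\<lambda>n. comp_C ln (k n) \<in> D \<and> norm (comp_C ln (k n) - comp_C ln h) \<le> e \<and>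
    norm (Hop S (comp_C ln (k n)) - Hop S (comp_C ln h)) \<le> e) sequentially"
  proof eventually_elim
    case (elim n)
    have "0 < k n x" for x using elim(1) m(1) less_le_trans[of 0 "m/2" "k n x"] by simp
    then have "comp_C ln (k n) \<in> D" by (intro smooth_closed k smooth_on_ln) auto
    with elim show ?case by (auto simp: dist_norm)
  qed
  then show thesis using that by (auto simp: eventually_sequentially)
qed

text \<open>The generator commutes with the semigroup, so along the orbit of \<open>h\<close> it is
  again an orbit, namely that of \<open>gen S h\<close>, and is norm continuous.\<close>

lemma continuous_on_Hop_ln_S:
  assumes h: "h \<in> gen_dom S" and pos: "\<And>x. 0 < h x"
  shows "continuous_on {0..} (\<lambda>p. Hop S (comp_C ln (S p h)))"
  unfolding continuous_on_def
proof
  fix p :: real assume p: "p \<in> {0..}"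
  have "((\<lambda>q. gen S (S q h)) \<longlongrightarrow> gen S (S p h)) (at p within {0..})"
  proof (rule Lim_transform_eventually)
    show "((\<lambda>q. S q (gen S h)) \<longlongrightarrow> gen S (S p h)) (at p within {0..})"
      using continuous_on_S[of "gen S h"] p by (simp add: continuous_on_def gen_S[OF h])
    show "eventually (\<lambda>q. S q (gen S h) = gen S (S q h)) (at p within {0..})"
      by (auto simp: eventually_at_filter gen_S[OF h])
  qed
  moreover have "((\<lambda>q. S q h) \<longlongrightarrow> S p h) (at p within {0..})"
    using continuous_on_S[of h] p by (simp add: continuous_on_def)
  ultimately show "((\<lambda>q. Hop S (comp_C ln (S q h))) \<longlongrightarrow> Hop S (comp_C ln (S p h))) (at p within {0..})"
    using p S_pos[OF _ pos] by (intro tendsto_Hop_ln[OF compact_E]) auto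
qed

text \<open>Contractivity of \<open>S q\<close> transports the backward error from time 0 to time
  \<open>q\<close>. The inequality ln z <= z - 1, for z the quotient of \<open>S q h\<close> by
  \<open>S (q + r) h\<close>, then turns the linear estimate into one for logarithms.\<close>

lemma ln_S_step_le:
  assumes h: "h \<in> gen_dom S" and m: "m > 0" "\<And>x. m \<le> h x"
    and err: "norm (S r h - h - r *\<^sub>R S r (gen S h)) \<le> r * (m * e)"
    and q: "q \<ge> 0" and r: "r > 0" and e: "e > 0"
  shows "comp_C ln (S q h) x \<le> (comp_C ln (S (q + r) h) - r *\<^sub>R Hop S (comp_C ln (S (q + r) h))) x + r * e"
proof -
  let ?p = "q + r"
  have p: "?p \<ge> 0" using q r by simp
  have pos: "0 < h x" for x using m(1) m(2)[of x] by simp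
  have "S q (S r h - h - r *\<^sub>R S r (gen S h)) = S ?p h - S q h - r *\<^sub>R S ?p (gen S h)"
    using q r by (simp add: S_diff S_scaleR S_add)
  then have "norm (S ?p h - S q h - r *\<^sub>R S ?p (gen S h)) \<le> r * (m * e)"
    using norm_S_le[OF q, of "S r h - h - r *\<^sub>R S r (gen S h)"] err by simp
  then have "\<bar>S ?p h x - S q h x - r * S ?p (gen S h) x\<bar> \<le> r * (m * e)"
    using norm_bounded[of "S ?p h - S q h - r *\<^sub>R S ?p (gen S h)" x] by simp
  \<comment> \<open>The factor \<open>m\<close> is a lower bound of \<open>S (q + r) h\<close>, so
    that the error becomes \<open>r * e\<close> after the division below.\<close>
  moreover have "r * (m * e) \<le> r * (S ?p h x * e)"
    using S_ge[OF p m(2)] r e by (intro mult_left_mono mult_right_mono) auto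
  ultimately have "S q h x \<le> S ?p h x - r * S ?p (gen S h) x + r * (S ?p h x * e)" by linarith
  then have "S q h x / S ?p h x \<le> (S ?p h x - r * S ?p (gen S h) x + r * (S ?p h x * e)) / S ?p h x"
    using S_pos[OF p pos, of x] by (intro divide_right_mono) auto
  also have "\<dots> = 1 - r * (S ?p (gen S h) x / S ?p h x) + r * e"
    using S_pos[OF p pos, of x] by (simp add: field_simps)
  finally have "ln (S q h x / S ?p h x) \<le> - r * (S ?p (gen S h) x / S ?p h x) + r * e"
    using ln_le_minus_one[of "S q h x / S ?p h x"] S_pos[OF p pos, of x] S_pos[OF q pos, of x] by simp
  moreover have "ln (S q h x / S ?p h x) = ln (S q h x) - ln (S ?p h x)"
    using S_pos[OF p pos, of x] S_pos[OF q pos, of x] by (simp add: ln_div)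
  ultimately show ?thesis
    using S_pos[OF p pos] S_pos[OF q pos] p q
    by (simp add: comp_ln_apply[OF compact_E] Hop_ln_apply[OF compact_E] gen_S[OF h])
qed

end

section \<open>Paths of measures\<close>

lemma velocity_increment:
  assumes vel: "is_velocity \<tau> \<nu> u" and f: "f \<in> topspace \<tau>" and ab: "0 \<le> a" "a \<le> b"
  shows "set_integrable lebesgue {a<..b} (\<lambda>s. u s f)"
    and "bracket f (\<nu> b) - bracket f (\<nu> a) = (LINT s:{a<..b}|lebesgue. u s f)"
proof -
  have int: "set_integrable lebesgue {0..b} (\<lambda>s. u s f)" if "0 \<le> b" for b
  proof -
    have "(\<lambda>s. u s f) \<in> borel_measurable (lebesgue_on {0..})"
      using vel f by (simp add: is_velocity_def)
    \<comment> \<open>Measurability is given on the half-line only; multiplying by its indicator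
      extends it to all reals, and the indicator of \<open>{0..b}\<close> then cuts down to the
      interval.\<close>
    then have "(\<lambda>s. indicator {0..} s *\<^sub>R u s f) \<in> borel_measurable lebesgue"
      by (subst (asm) borel_measurable_restrict_space_iff) auto
    moreover have "{0..b} \<in> sets lebesgue" by simp
    then have "(indicator {0..b} :: real \<Rightarrow> real) \<in> borel_measurable lebesgue"
      by (rule borel_measurable_indicator)
    ultimately have "(\<lambda>s. indicator {0..b} s *\<^sub>R (indicator {0..} s *\<^sub>R u s f)) \<in> borel_measurable lebesgue"
      by (rule borel_measurable_scaleR[rotated])
    moreover have "(\<lambda>s. indicator {0..b} s *\<^sub>R (indicator {0..} s *\<^sub>R u s f)) = (\<lambda>s. indicator {0..b} s *\<^sub>R u s f)"
      by (auto simp: indicator_def)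
    moreover have "(\<integral>\<^sup>+s\<in>{0..b}. ennreal \<bar>u s f\<bar> \<partial>lebesgue) < \<infinity>"
      using vel f that by (simp add: is_velocity_def)
    moreover have "(\<integral>\<^sup>+s\<in>{0..b}. ennreal \<bar>u s f\<bar> \<partial>lebesgue) = (\<integral>\<^sup>+s. ennreal (norm (indicator {0..b} s *\<^sub>R u s f)) \<partial>lebesgue)"
      by (intro nn_integral_cong) (auto simp: indicator_def)
    ultimately show ?thesis
      unfolding set_integrable_def by (intro integrableI_bounded) auto
  qed
  show ab_int: "set_integrable lebesgue {a<..b} (\<lambda>s. u s f)"
    using int[of b] ab by (rule_tac set_integrable_subset) auto
  have "bracket f (\<nu> c) - bracket f (\<nu> 0) = (LINT s:{0..c}|lebesgue. u s f)" if "0 \<le> c" for c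
    using vel f that by (simp add: is_velocity_def)
  moreover have "(LINT s:{0..a} \<union> {a<..b}|lebesgue. u s f)
      = (LINT s:{0..a}|lebesgue. u s f) + (LINT s:{a<..b}|lebesgue. u s f)"
    using ab by (intro set_integral_Un int ab_int) auto
  moreover have "{0..a} \<union> {a<..b} = {0..b}" using ab by auto
  ultimately show "bracket f (\<nu> b) - bracket f (\<nu> a) = (LINT s:{a<..b}|lebesgue. u s f)"
    using ab by (smt (verit))
qed

lemma set_integrable_lebesgue_continuous:
  fixes f :: "real \<Rightarrow> real"
  assumes "continuous_on {a..b} f"
  shows "set_integrable lebesgue {a<..b} f"
proof -
  have "set_integrable lborel {a..b} f"
    using assms by (rule borel_integrable_atLeastAtMost')
  then have "set_integrable lebesgue {a..b} f"
    unfolding set_integrable_def using integrable_completion borel_measurable_integrable by blast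
  then show ?thesis by (rule set_integrable_subset) auto
qed

text \<open>The coercion \<open>ennreal\<close> sends negative values to 0, so the right side
  integrates the positive part of \<open>v\<close>.\<close>

lemma ereal_integral_le_nn_integral:
  fixes v :: "'b \<Rightarrow> real"
  assumes "integrable N v"
  shows "ereal (integral\<^sup>L N v) \<le> enn2ereal (\<integral>\<^sup>+x. ennreal (v x) \<partial>N)"
proof -
  have int: "integrable N (\<lambda>x. max 0 (v x))" using assms by simp
  have "integral\<^sup>L N v \<le> (\<integral>x. max 0 (v x) \<partial>N)"
    by (intro integral_mono assms int) auto
  also have "ereal \<dots> = enn2ereal (ennreal (\<integral>x. max 0 (v x) \<partial>N))"
    by (intro enn2ereal_ennreal[symmetric] integral_nonneg) auto
  also have "ennreal (\<integral>x. max 0 (v x) \<partial>N) = (\<integral>\<^sup>+x. ennreal (max 0 (v x)) \<partial>N)"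
    by (intro nn_integral_eq_integral[symmetric] int) auto
  also have "\<dots> = (\<integral>\<^sup>+x. ennreal (v x) \<partial>N)"
    by (intro nn_integral_cong) (auto simp: max_def ennreal_neg)
  finally show ?thesis by simp
qed

section \<open>One time step along a path of measures\<close>

lemma (in feller_core) bracket_ln_S_step_le:
  assumes h: "h \<in> gen_dom S" and m: "m > 0" "\<And>x. m \<le> h x"
    and err: "norm (S r h - h - r *\<^sub>R S r (gen S h)) \<le> r * (m * e)"
    and q: "q \<ge> 0" and r: "r > 0" and e: "e > 0"
    and \<nu>: "\<nu> \<in> AC \<tau> \<mu>" and vel: "is_velocity \<tau> \<nu> u" and a: "a \<ge> 0"
    and osc: "\<And>s. s \<in> {a..a + r} \<Longrightarrow>
      \<bar>bracket (Hop S (comp_C ln (S (q + r) h))) (\<nu> s) - bracket (Hop S (comp_C ln (S (q + r) h))) (\<nu> (a + r))\<bar> \<le> e"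
  obtains g where "g \<in> D"
    "set_integrable lebesgue {a<..a + r} (\<lambda>s. u s g - bracket (Hop S g) (\<nu> s))"
    "bracket (comp_C ln (S q h)) (\<nu> (a + r)) - bracket (comp_C ln (S (q + r) h)) (\<nu> a)
       \<le> (LINT s:{a<..a + r}|lebesgue. u s g - bracket (Hop S g) (\<nu> s)) + 5 * (r * e)"
proof -
  define b where "b = a + r"
  define F where "F = comp_C ln (S (q + r) h)"
  define K where "K = Hop S F"
  have pos: "0 < h x" for x using m(1) m(2)[of x] by simp
  have Sh: "S (q + r) h \<in> gen_dom S" "\<And>x. 0 < S (q + r) h x"
    using h pos q r by (auto intro: S_gen_dom S_pos)
  \<comment> \<open>The values of \<open>g\<close> enter without integration and need tolerance
    \<open>r * e\<close>; H of \<open>g\<close> is integrated over length \<open>r\<close> and needs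
    only \<open>e\<close>.\<close>
  obtain g where g: "g \<in> D" "norm (g - F) \<le> min e (r * e)" "norm (Hop S g - K) \<le> min e (r * e)"
    using core_approximation[OF Sh, of "min e (r * e)"] r e unfolding F_def K_def by auto
  have Prob: "\<nu> s \<in> Prob" if "s \<ge> 0" for s using AC_Prob[OF \<nu> that] .
  have b: "b \<ge> 0" "a \<le> b" using a r by (auto simp: b_def)
  have gtop: "g \<in> topspace \<tau>" using g(1) topspace_D by simp
  have Hint: "set_integrable lebesgue {a<..b} (\<lambda>s. bracket (Hop S g) (\<nu> s))"
    using a by (intro set_integrable_lebesgue_continuous
        continuous_on_subset[OF AC_continuous_bracket[OF \<nu>]]) auto
  note uint = velocity_increment[OF vel gtop a b(2)]
  have const: "set_integrable lebesgue {a<..b} (\<lambda>s. bracket K (\<nu> b) + 2 * e)"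
    by (intro set_integrable_lebesgue_continuous continuous_on_const)
  have "(LINT s:{a<..b}|lebesgue. bracket (Hop S g) (\<nu> s)) \<le> (LINT s:{a<..b}|lebesgue. bracket K (\<nu> b) + 2 * e)"
  proof (rule set_integral_mono[OF Hint const])
    fix s assume s: "s \<in> {a<..b}"
    then have "\<nu> s \<in> Prob" using a by (intro Prob) auto
    from abs_bracket_diff_le[OF this, of "Hop S g" K] osc[of s] s g(3)
    show "bracket (Hop S g) (\<nu> s) \<le> bracket K (\<nu> b) + 2 * e"
      by (auto simp: b_def K_def F_def)
  qed
  also have "\<dots> = r * (bracket K (\<nu> b) + 2 * e)"
    using r by (simp add: set_lebesgue_integral_def b_def)
  finally have H: "(LINT s:{a<..b}|lebesgue. bracket (Hop S g) (\<nu> s)) \<le> r * bracket K (\<nu> b) + 2 * (r * e)"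
    by (simp add: algebra_simps)
  have "bracket (comp_C ln (S q h)) (\<nu> b) \<le> bracket (F - r *\<^sub>R K) (\<nu> b) + r * e"
    using ln_S_step_le[OF h m err q r e] unfolding F_def K_def by (intro bracket_le Prob b) auto
  then have "bracket (comp_C ln (S q h)) (\<nu> b) \<le> bracket F (\<nu> b) - r * bracket K (\<nu> b) + r * e"
    by (simp add: bracket_diff[OF Prob[OF b(1)]] bracket_scaleR)
  moreover have "\<bar>bracket g (\<nu> b) - bracket F (\<nu> b)\<bar> \<le> r * e" "\<bar>bracket g (\<nu> a) - bracket F (\<nu> a)\<bar> \<le> r * e"
    using abs_bracket_diff_le[OF Prob[OF b(1)], of g F] abs_bracket_diff_le[OF Prob[OF a], of g F] g(2) by auto
  moreover have "(LINT s:{a<..b}|lebesgue. u s g - bracket (Hop S g) (\<nu> s)) =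
      (LINT s:{a<..b}|lebesgue. u s g) - (LINT s:{a<..b}|lebesgue. bracket (Hop S g) (\<nu> s))"
    by (intro set_integral_diff uint Hint)
  ultimately have "bracket (comp_C ln (S q h)) (\<nu> b) - bracket F (\<nu> a)
      \<le> (LINT s:{a<..b}|lebesgue. u s g - bracket (Hop S g) (\<nu> s)) + 5 * (r * e)"
    using H uint(2) by linarith
  moreover have "set_integrable lebesgue {a<..b} (\<lambda>s. u s g - bracket (Hop S g) (\<nu> s))"
    by (intro set_integral_diff uint Hint)
  ultimately show thesis using that g(1) unfolding b_def F_def by blast
qed

text \<open>Varying \<open>p\<close> costs at most the norm of the change of \<open>K\<close>,
  whatever the probability measure, and for fixed \<open>p\<close> weak continuity of the path
  applies. Compactness of the square gives one \<open>d\<close> valid for all \<open>p\<close>, as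
  the grid argument requires.\<close>

lemma bracket_uniformly_continuous:
  fixes K :: "real \<Rightarrow> 'a::metric_space \<Rightarrow>\<^sub>C real"
  assumes \<nu>: "\<nu> \<in> AC \<tau> \<mu>" and K: "continuous_on {0..} K" and "e > 0"
  obtains d where "d > 0" "\<And>p s s'. p \<in> {0..t} \<Longrightarrow> s \<in> {0..t} \<Longrightarrow> s' \<in> {0..t} \<Longrightarrow> \<bar>s - s'\<bar> < d \<Longrightarrow>
    \<bar>bracket (K p) (\<nu> s) - bracket (K p) (\<nu> s')\<bar> \<le> e"
proof -
  let ?\<phi> = "\<lambda>(p, s). bracket (K p) (\<nu> s)"
  let ?Q = "{0..t} \<times> {0..t}"
  have "continuous_on ?Q ?\<phi>"
    unfolding continuous_on_def
  proof
    fix x assume x: "x \<in> ?Q"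
    obtain p s where [simp]: "x = (p, s)" by (cases x)
    have s: "s \<in> {0..}" "p \<in> {0..}" using x by auto
    have "continuous_on ?Q (\<lambda>y. K (fst y))"
      by (rule continuous_on_compose2[OF K]) (auto intro!: continuous_intros)
    then have "((\<lambda>y. norm (K (fst y) - K p)) \<longlongrightarrow> norm (K (fst x) - K p)) (at x within ?Q)"
      using x by (intro tendsto_norm tendsto_diff tendsto_const) (auto simp: continuous_on_def)
    then have lim1: "((\<lambda>y. norm (K (fst y) - K p)) \<longlongrightarrow> 0) (at x within ?Q)" by simp
    \<comment> \<open>This bound is uniform in the measure, so the measure may move together with
      \<open>p\<close>.\<close>
    have "norm (bracket (K (fst y)) (\<nu> (snd y)) - bracket (K p) (\<nu> (snd y))) \<le> norm (K (fst y) - K p)"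
      if "y \<in> ?Q" for y
      using that by (auto intro!: abs_bracket_diff_le AC_Prob[OF \<nu>])
    then have "eventually (\<lambda>y. norm (bracket (K (fst y)) (\<nu> (snd y)) - bracket (K p) (\<nu> (snd y))) \<le> norm (K (fst y) - K p)) (at x within ?Q)"
      by (auto simp: eventually_at_filter)
    from Lim_null_comparison[OF this lim1]
    have A: "((\<lambda>y. bracket (K (fst y)) (\<nu> (snd y)) - bracket (K p) (\<nu> (snd y))) \<longlongrightarrow> 0) (at x within ?Q)" .
    have "continuous_on ?Q (\<lambda>y. bracket (K p) (\<nu> (snd y)))"
      by (rule continuous_on_compose2[OF AC_continuous_bracket[OF \<nu>]]) (auto intro!: continuous_intros)
    then have "((\<lambda>y. bracket (K p) (\<nu> (snd y))) \<longlongrightarrow> bracket (K p) (\<nu> s)) (at x within ?Q)"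
      using x by (force simp: continuous_on_def)
    from tendsto_add[OF A this] show "(?\<phi> \<longlongrightarrow> ?\<phi> x) (at x within ?Q)" by (simp add: case_prod_unfold)
  qed
  then have "uniformly_continuous_on ?Q ?\<phi>"
    by (intro compact_uniformly_continuous compact_Times compact_Icc)
  then obtain d where d: "d > 0"
    "\<And>x x'. x \<in> ?Q \<Longrightarrow> x' \<in> ?Q \<Longrightarrow> dist x' x < d \<Longrightarrow> dist (?\<phi> x') (?\<phi> x) < e"
    using \<open>e > 0\<close> by (metis uniformly_continuous_on_def)
  show thesis
  proof (rule that[OF d(1)])
    fix p s s' assume "p \<in> {0..t}" "s \<in> {0..t}" "s' \<in> {0..t}" "\<bar>s - s'\<bar> < d"
    then show "\<bar>bracket (K p) (\<nu> s) - bracket (K p) (\<nu> s')\<bar> \<le> e"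
      using d(2)[of "(p, s')" "(p, s)"] by (simp add: dist_prod_def dist_real_def)
  qed
qed

section \<open>Summation over a time grid\<close>

lemma grid_interval_unique:
  fixes r :: real
  assumes "r > 0" "s \<in> {real i * r<..real (Suc i) * r}" "s \<in> {real j * r<..real (Suc j) * r}"
  shows "i = j"
proof -
  have "real i * r < real (Suc j) * r" "real j * r < real (Suc i) * r"
    using assms(2,3) by (auto intro: less_le_trans)
  then have "real i < real (Suc j)" "real j < real (Suc i)"
    using assms(1) by (auto simp only: mult_less_cancel_right_pos)
  then show ?thesis by simp
qed

lemma (in feller_core) Vlog_inequality_gen_dom_eps:
  assumes h: "h \<in> gen_dom S" and pos: "\<And>x. 0 < h x"
    and \<nu>: "\<nu> \<in> AC \<tau> \<mu>" and vel: "is_velocity \<tau> \<nu> u" and t: "t > 0" and e: "e > 0"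
  shows "ereal (bracket (comp_C ln h) (\<nu> t) - bracket (comp_C ln (S t h)) (\<nu> 0) - 5 * t * e)
    \<le> enn2ereal (\<integral>\<^sup>+s\<in>{0..t}. e2ennreal (Lagrangian S (topspace \<tau>) (\<nu> s) (u s)) \<partial>lebesgue)"
proof -
  let ?K = "\<lambda>p. Hop S (comp_C ln (S p h))"
  obtain m where m: "m > 0" "\<And>x. m \<le> h x" using positive_lower_bound[OF compact_E pos] by blast
  obtain d where d: "d > 0" "\<And>p s s'. p \<in> {0..t} \<Longrightarrow> s \<in> {0..t} \<Longrightarrow> s' \<in> {0..t} \<Longrightarrow> \<bar>s - s'\<bar> < d \<Longrightarrow>
    \<bar>bracket (?K p) (\<nu> s) - bracket (?K p) (\<nu> s')\<bar> \<le> e"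
    using bracket_uniformly_continuous[OF \<nu> continuous_on_Hop_ln_S[OF h pos] e, of t] by blast
  obtain d' where d': "d' > 0" "\<And>r. 0 < r \<Longrightarrow> r < d' \<Longrightarrow> norm (S r h - h - r *\<^sub>R S r (gen S h)) \<le> r * (m * e)"
    using eventually_backward_error_le[OF h, of "m * e"] m(1) e by (auto simp: eventually_at_right_field)
  \<comment> \<open>The mesh t/n has to lie below \<open>d\<close>, for the oscillation along the
    path, and below \<open>d'\<close>, for the backward error.\<close>
  obtain n where n: "t / min d d' < real n" using reals_Archimedean2 by blast
  define r where "r = t / real n"
  have n0: "n > 0" using n t d(1) d'(1) by (cases n) (auto simp: divide_less_0_iff split: if_splits)
  have "min d d' > 0" using d(1) d'(1) by simp
  then have "r < min d d'"
    using n n0 by (simp only: r_def pos_divide_less_eq of_nat_0_less_iff mult.commute)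
  then have r: "r > 0" "r < d" "r < d'" "real n * r = t"
    using n0 t by (auto simp: r_def)
  define I where "I i = {real i * r<..real (Suc i) * r}" for i
  let ?w = "\<lambda>g s. u s g - bracket (Hop S g) (\<nu> s)"
  \<comment> \<open>The two clocks run in opposite directions: \<open>\<phi> 0\<close> is the
    bracket of ln \<open>S t h\<close> under the initial measure, and \<open>\<phi> n\<close> that
    of ln \<open>h\<close> under the final one.\<close>
  define \<phi> where "\<phi> i = bracket (comp_C ln (S (t - real i * r) h)) (\<nu> (real i * r))" for i
  define Q where "Q i g \<longleftrightarrow> g \<in> D \<and> set_integrable lebesgue (I i) (?w g) \<and>
      \<phi> (Suc i) - \<phi> i \<le> (LINT s:I i|lebesgue. ?w g s) + 5 * (r * e)" for i g
  have ex: "\<exists>g. Q i g" if i: "i < n" for i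
  proof -
    \<comment> \<open>The semigroup time left at the end of step \<open>i\<close>; at its beginning
      it is \<open>q + r\<close>.\<close>
    define q where "q = t - real (Suc i) * r"
    have "real (Suc i) * r \<le> real n * r" using i r(1) by (intro mult_right_mono) auto
    then have q: "q \<ge> 0" "q + r = t - real i * r" "real i * r + r = real (Suc i) * r"
      "q + r \<in> {0..t}" "real (Suc i) * r \<le> t"
      using r(4) r(1) by (auto simp: q_def algebra_simps)
    have osc: "\<bar>bracket (?K (q + r)) (\<nu> s) - bracket (?K (q + r)) (\<nu> (real i * r + r))\<bar> \<le> e"
      if "s \<in> {real i * r..real i * r + r}" for s
    proof -
      have "s \<in> {0..t}" "real i * r + r \<in> {0..t}" "\<bar>s - (real i * r + r)\<bar> < d"
        using that q r by (auto intro: order_trans[of 0 "real i * r"])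
      with d(2)[OF q(4)] show ?thesis by blast
    qed
    have "0 \<le> real i * r" using r(1) by simp
    obtain g where g: "g \<in> D" "set_integrable lebesgue {real i * r<..real i * r + r} (?w g)"
      "bracket (comp_C ln (S q h)) (\<nu> (real i * r + r)) - bracket (comp_C ln (S (q + r) h)) (\<nu> (real i * r))
        \<le> (LINT s:{real i * r<..real i * r + r}|lebesgue. ?w g s) + 5 * (r * e)"
      by (rule bracket_ln_S_step_le[OF h m d'(2)[OF r(1,3)] q(1) r(1) e \<nu> vel \<open>0 \<le> real i * r\<close> osc])
    moreover have "\<phi> (Suc i) = bracket (comp_C ln (S q h)) (\<nu> (real i * r + r))"
      unfolding \<phi>_def q(3) q_def ..
    moreover have "\<phi> i = bracket (comp_C ln (S (q + r) h)) (\<nu> (real i * r))"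
      unfolding \<phi>_def q(2) ..
    moreover have "I i = {real i * r<..real i * r + r}"
      unfolding I_def q(3) ..
    ultimately have "Q i g" unfolding Q_def by simp
    then show ?thesis ..
  qed
  define g where "g i = (SOME g. Q i g)" for i
  have "Q i (g i)" if "i < n" for i unfolding g_def by (rule someI_ex[OF ex[OF that]])
  then have g: "\<And>i. i < n \<Longrightarrow> g i \<in> D" "\<And>i. i < n \<Longrightarrow> set_integrable lebesgue (I i) (?w (g i))"
    "\<And>i. i < n \<Longrightarrow> \<phi> (Suc i) - \<phi> i \<le> (LINT s:I i|lebesgue. ?w (g i) s) + 5 * (r * e)"
    unfolding Q_def by blast+
  \<comment> \<open>The Lagrangian is compared with one measurable function on all of \<open>[0, t]\<close>: splitting its
    integral into steps would require its measurability.\<close>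
  define v where "v s = (\<Sum>i<n. indicator (I i) s *\<^sub>R ?w (g i) s)" for s
  have w_int: "integrable lebesgue (\<lambda>s. indicator (I i) s *\<^sub>R ?w (g i) s)" if "i \<in> {..<n}" for i
    using g(2) that unfolding set_integrable_def by simp
  have v_int: "integrable lebesgue v"
    unfolding v_def by (rule Bochner_Integration.integrable_sum[OF w_int])
  have v_eq: "integral\<^sup>L lebesgue v = (\<Sum>i<n. LINT s:I i|lebesgue. ?w (g i) s)"
    unfolding v_def set_lebesgue_integral_def by (rule Bochner_Integration.integral_sum[OF w_int])
  \<comment> \<open>The increments telescope, and the \<open>n\<close> errors add up to
    \<open>5 * t * e\<close> because n r = t.\<close>
  have "\<phi> n - \<phi> 0 = (\<Sum>i<n. \<phi> (Suc i) - \<phi> i)" by (simp add: sum_lessThan_telescope)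
  also have "\<dots> \<le> (\<Sum>i<n. (LINT s:I i|lebesgue. ?w (g i) s) + 5 * (r * e))"
    by (intro sum_mono g(3)) auto
  also have "\<dots> = integral\<^sup>L lebesgue v + 5 * t * e"
    by (simp add: sum.distrib v_eq r(4)[symmetric])
  finally have "bracket (comp_C ln h) (\<nu> t) - bracket (comp_C ln (S t h)) (\<nu> 0) - 5 * t * e \<le> integral\<^sup>L lebesgue v"
    by (simp add: \<phi>_def r(4) S_0)
  then have "ereal (bracket (comp_C ln h) (\<nu> t) - bracket (comp_C ln (S t h)) (\<nu> 0) - 5 * t * e) \<le> ereal (integral\<^sup>L lebesgue v)"
    by simp
  also have "\<dots> \<le> enn2ereal (\<integral>\<^sup>+s. ennreal (v s) \<partial>lebesgue)"
    by (rule ereal_integral_le_nn_integral[OF v_int])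
  also have "\<dots> \<le> enn2ereal (\<integral>\<^sup>+s\<in>{0..t}. e2ennreal (Lagrangian S (topspace \<tau>) (\<nu> s) (u s)) \<partial>lebesgue)"
  proof (subst less_eq_ennreal.rep_eq[symmetric], rule nn_integral_mono)
    fix s
    show "ennreal (v s) \<le> e2ennreal (Lagrangian S (topspace \<tau>) (\<nu> s) (u s)) * indicator {0..t} s"
    proof (cases "\<exists>i<n. s \<in> I i")
      case False
      \<comment> \<open>This covers times outside [0, t] and also time 0, which no left-open step
        contains.\<close>
      then have "v s = 0" by (auto simp: v_def indicator_def intro!: sum.neutral)
      then show ?thesis by simp
    next
      case True
      then obtain i where i: "i < n" "s \<in> I i" by blast
      have "v s = (\<Sum>j\<in>{i}. indicator (I j) s *\<^sub>R ?w (g j) s)"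
        unfolding v_def using i grid_interval_unique[OF r(1)]
        by (intro sum.mono_neutral_right) (auto simp: I_def indicator_def)
      then have "v s = ?w (g i) s" using i by simp
      moreover have "ereal (?w (g i) s) \<le> Lagrangian S (topspace \<tau>) (\<nu> s) (u s)"
        unfolding Lagrangian_def topspace_D using g(1)[OF i(1)] by (rule SUP_upper)
      then have "ennreal (?w (g i) s) \<le> e2ennreal (Lagrangian S (topspace \<tau>) (\<nu> s) (u s))"
        using e2ennreal_mono by (metis e2ennreal_ereal)
      moreover have "real (Suc i) * r \<le> real n * r" "0 \<le> real i * r"
        using i(1) r(1) by (auto intro!: mult_right_mono)
      then have "s \<in> {0..t}" using i(2) r(4) by (auto simp: I_def)
      ultimately show ?thesis by simp
    qed
  qed
  finally show ?thesis .
qed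

section \<open>Removal of the error and passage to arbitrary f\<close>

lemma (in feller_core) Vlog_inequality_gen_dom:
  assumes h: "h \<in> gen_dom S" and pos: "\<And>x. 0 < h x"
    and \<nu>: "\<nu> \<in> AC \<tau> \<mu>" and vel: "is_velocity \<tau> \<nu> u" and t: "t > 0"
    and J: "(\<integral>\<^sup>+s\<in>{0..t}. e2ennreal (Lagrangian S (topspace \<tau>) (\<nu> s) (u s)) \<partial>lebesgue) = ennreal J" "J \<ge> 0"
  shows "bracket (comp_C ln h) (\<nu> t) \<le> bracket (comp_C ln (S t h)) (\<nu> 0) + J"
proof (rule field_le_epsilon)
  fix e :: real assume "e > 0"
  then have "5 * t * (e / (5 * t)) = e" "e / (5 * t) > 0" using t by auto
  with Vlog_inequality_gen_dom_eps[OF h pos \<nu> vel t, of "e / (5 * t)"]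
  show "bracket (comp_C ln h) (\<nu> t) \<le> bracket (comp_C ln (S t h)) (\<nu> 0) + J + e"
    by (simp add: J enn2ereal_ennreal)
qed

lemma (in feller_core) Vlog_inequality:
  assumes \<nu>: "\<nu> \<in> AC \<tau> \<mu>" and vel: "is_velocity \<tau> \<nu> u" and t: "t > 0"
    and J: "(\<integral>\<^sup>+s\<in>{0..t}. e2ennreal (Lagrangian S (topspace \<tau>) (\<nu> s) (u s)) \<partial>lebesgue) = ennreal J" "J \<ge> 0"
  shows "bracket f (\<nu> t) \<le> bracket (Vlog S t f) (\<nu> 0) + J"
proof -
  let ?h = "comp_C exp f"
  have pos: "0 < ?h x" for x by (simp add: comp_exp_apply[OF compact_E])
  obtain m where m: "m > 0" "\<And>x. m \<le> ?h x" using positive_lower_bound[OF compact_E pos] by blast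
  \<comment> \<open>Density is applied to e^f rather than to f, since the inequality for the
    generator domain is stated for the exponentiated function.\<close>
  obtain k where k: "\<And>n::nat. k n \<in> D" "k \<longlonglongrightarrow> ?h"
    using dense by (metis UNIV_I closure_sequential)
  have Sk: "(\<lambda>n. S t (k n)) \<longlonglongrightarrow> S t ?h"
    using t by (intro bounded_linear.tendsto[OF S_linear k(2)]) auto
  have "eventually (\<lambda>n. \<forall>x. m / 2 \<le> k n x) sequentially"
    using m by (intro eventually_bounded_below_bcontfun[OF k(2) _ m(2)]) auto
  then have ev: "eventually (\<lambda>n. bracket (comp_C ln (k n)) (\<nu> t) \<le> bracket (comp_C ln (S t (k n))) (\<nu> 0) + J) sequentially"
  proof eventually_elim
    case (elim n)
    have pos: "0 < k n x" for x using elim m(1) less_le_trans[of 0 "m/2" "k n x"] by simp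
    show ?case using k(1) D_subset by (intro Vlog_inequality_gen_dom[OF _ pos \<nu> vel t J]) auto
  qed
  have "(\<lambda>n. bracket (comp_C ln (k n)) (\<nu> t)) \<longlonglongrightarrow> bracket (comp_C ln ?h) (\<nu> t)"
    using t by (intro tendsto_bracket AC_Prob[OF \<nu>] tendsto_comp_ln[OF compact_E k(2) pos]) auto
  moreover have "(\<lambda>n. bracket (comp_C ln (S t (k n))) (\<nu> 0) + J) \<longlonglongrightarrow> bracket (comp_C ln (S t ?h)) (\<nu> 0) + J"
    using t by (intro tendsto_add tendsto_const tendsto_bracket AC_Prob[OF \<nu>] tendsto_comp_ln[OF compact_E Sk] S_pos pos) auto
  ultimately show ?thesis
    using tendsto_le[OF _ _ _ ev] by (simp add: comp_ln_exp[OF compact_E] Vlog_def)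
qed

theorem proposition4p12:
  fixes M :: "'w measure"
    and P :: "'a::metric_space \<Rightarrow> 'w measure"
    and X :: "real \<Rightarrow> 'w \<Rightarrow> 'a"
    and S :: "real \<Rightarrow> ('a \<Rightarrow>\<^sub>C real) \<Rightarrow> ('a \<Rightarrow>\<^sub>C real)"
    and D :: "('a \<Rightarrow>\<^sub>C real) set"
    and \<tau> :: "('a \<Rightarrow>\<^sub>C real) topology"
    and f :: "'a \<Rightarrow>\<^sub>C real"
    and \<mu> :: "'a measure"
    and t :: real
  assumes "compact (UNIV :: 'a set)"
    and "cadlag_markov_process M P X S"
    and "strongly_continuous_semigroup S"
    and "core_conditions S D \<tau>"
    and "t \<ge> 0"
    and "\<mu> \<in> Prob"
  shows "Vbold S \<tau> t (bracket f) \<mu> \<le> ereal (bracket (Vlog S t f) \<mu>)"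
proof -
  interpret feller_core M P X S D \<tau>
    using assms by (simp add: feller_core_def feller_core_axioms_def)
  show ?thesis
    unfolding Vbold_def
  proof (rule SUP_least)
    fix \<nu> assume \<nu>: "\<nu> \<in> AC \<tau> \<mu>"
    then have "\<exists>u. is_velocity \<tau> \<nu> u" and "\<nu> 0 = \<mu>" by (auto simp: AC_def)
    then have vel: "is_velocity \<tau> \<nu> (velocity \<tau> \<nu>)" by (simp add: velocity_def someI_ex)
    define J where "J = (\<integral>\<^sup>+s\<in>{0..t}. e2ennreal (Lagrangian S (topspace \<tau>) (\<nu> s) (velocity \<tau> \<nu> s)) \<partial>lebesgue)"
    have "ereal (bracket f (\<nu> t)) - enn2ereal J \<le> ereal (bracket (Vlog S t f) \<mu>)"
    proof (cases J)
      case (real j)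
      \<comment> \<open>At \<open>t = 0\<close> both semigroups reduce to the identity and
        \<open>j\<close> is nonnegative; the grid argument needs positive \<open>t\<close>. A path
        of infinite cost contributes minus infinity and is settled by the closing
        \<open>simp\<close>.\<close>
      have "bracket f (\<nu> t) \<le> bracket (Vlog S t f) \<mu> + j"
      proof (cases "t = 0")
        case True
        then show ?thesis
          using real \<open>\<nu> 0 = \<mu>\<close> by (simp add: Vlog_def S_0 comp_ln_exp[OF compact_E])
      next
        case False
        then show ?thesis
          using Vlog_inequality[OF \<nu> vel, of t j f] real assms(5) \<open>\<nu> 0 = \<mu>\<close> by (simp add: J_def)
      qed
      with real show ?thesis by (simp add: enn2ereal_ennreal)
    qed simp
    then show "ereal (bracket f (\<nu> t)) - enn2ereal (\<integral>\<^sup>+s\<in>{0..t}. e2ennreal (Lagrangian S (topspace \<tau>) (\<nu> s) (velocity \<tau> \<nu> s)) \<partial>lebesgue)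
        \<le> ereal (bracket (Vlog S t f) \<mu>)"
      unfolding J_def .
  qed
qed

end
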